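(* Let $M=\mathbb{R}^2$ with global null coordinates $(u,v)$, the Minkowski metric $g = 2\,du\,dv$, and the time orientation for which a vector $A\partial_u + B\partial_v$ is future directed causal if and only if $A,B\ge 0$ and $\max(A,B)>0$. Let $h = du^2+dv^2$ be the Euclidean metric. Let $$\tau(u,v) := F(u) + v,\qquad F(u) := u + \tfrac{u^3}{3},$$ and $\Sigma_s := \{\tau = s\}$ for $s\in\mathbb{R}$. Then $\tau$ is a Cauchy temporal function which is steep and $h$-steep, i.e. $d\tau(V) \ge \max(|V|_h, |V|_g)$ for every future directed causal vector $V$, but the family $\{\ell(\cdot,\Sigma_t)\}_{t>0}$ is not locally equi-Lipschitz on $M$.
   Context: Lorentzian metrics have signature $(+,-,\dots,-)$; $v$ is timelike if $g(v,v)>0$, null if $g(v,v)=0$ and $v\ne0$, causal if timelike or null. For causal $v$, $|v|_g := \sqrt{g(v,v)}$; $|v|_h := \sqrt{h(v,v)}$. The time separation function $\ell: M^2\to\{-\infty\}\cup[0,\infty)$ is $\ell(x,y) = $ the supremum of the $g$-lengths of future directed causal curves from $x$ to $y$ if $x\le y$ (with $\ell(x,x)=0$), and $\ell(x,y)=-\infty$ if $x\not\le y$. For sets, $\ell(A,B) := \sup_{x\in A,\,y\in B}\ell(x,y)$, and $\ell(x,B) := \ell(\{x\},B)$. A function $\tau\in C^\infty(M)$ is temporal if $\nabla\tau$ (the $g$-gradient, $g(\nabla\tau,\cdot)=d\tau$) is future directed timelike; it is Cauchy if each level set $\{\tau=s\}$, $s\in\mathbb{R}$, is a Cauchy hypersurface.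 The family $\{\ell(\cdot,\Sigma_t)\}_{t>0}$ is called locally equi-Lipschitz on $M$ if every $q\in M$ has an open neighborhood $U$ for which there exist $C>0$ and $t_0>0$ such that for all $t\ge t_0$ one has $U\subseteq I^-(\Sigma_t)$ and $\ell(\cdot,\Sigma_t)$ is $C$-Lipschitz on $U$ with respect to the distance $d_h$ induced by $h$. *)

theory Defs
  imports "HOL-Analysis.Analysis"
begin

(* The manifold is a Euclidean space, with each tangent space identified with the
   space itself.  A metric is a field k of bilinear forms (k p V W is the value at p on V and W);
   a time orientation is given by the predicate fut, where fut p V means that V is a
   future directed causal vector at p. *)

section \<open>Curves and lengths\<close>

(* On every piece of the partition S the curve is C^1 up to and including the endpoints, and
   all its velocities, the one-sided ones at the break points included, satisfy P. *)
definition pw_C1_curve ::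
  "('a::euclidean_space \<Rightarrow> 'a \<Rightarrow> bool) \<Rightarrow> (real \<Rightarrow> 'a) \<Rightarrow> real \<Rightarrow> real \<Rightarrow> bool" where
  "pw_C1_curve P \<gamma> a b \<longleftrightarrow> a < b \<and>
     (\<exists>S. finite S \<and> {a, b} \<subseteq> S \<and> S \<subseteq> {a..b} \<and>
       (\<forall>c\<in>S. \<forall>d\<in>S. c < d \<and> {c<..<d} \<inter> S = {} \<longrightarrow>
         (\<exists>\<gamma>'. continuous_on {c..d} \<gamma>' \<and>
           (\<forall>t\<in>{c..d}. (\<gamma> has_vector_derivative \<gamma>' t) (at t within {c..d}) \<and> P (\<gamma> t) (\<gamma>' t)))))"

(* The finitely many break points, where vector_derivative carries no information, do not
   affect the integral. *)
definition curve_length ::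
  "('a::euclidean_space \<Rightarrow> 'a \<Rightarrow> 'a \<Rightarrow> real) \<Rightarrow> (real \<Rightarrow> 'a) \<Rightarrow> real \<Rightarrow> real \<Rightarrow> real" where
  "curve_length k \<gamma> a b =
     integral {a..b} (\<lambda>t. sqrt (k (\<gamma> t) (vector_derivative \<gamma> (at t)) (vector_derivative \<gamma> (at t))))"

definition riem_dist ::
  "('a::euclidean_space \<Rightarrow> 'a \<Rightarrow> 'a \<Rightarrow> real) \<Rightarrow> 'a \<Rightarrow> 'a \<Rightarrow> real" where
  "riem_dist h x y =
     Inf {curve_length h \<gamma> a b |\<gamma> a b. pw_C1_curve (\<lambda>_ _. True) \<gamma> a b \<and> \<gamma> a = x \<and> \<gamma> b = y}"

section \<open>Causality\<close>

definition future_timelike ::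
  "('a \<Rightarrow> 'a \<Rightarrow> 'a \<Rightarrow> real) \<Rightarrow> ('a \<Rightarrow> 'a \<Rightarrow> bool) \<Rightarrow> 'a \<Rightarrow> 'a \<Rightarrow> bool" where
  "future_timelike g fut p V \<longleftrightarrow> fut p V \<and> g p V V > 0"

definition causal_le :: "('a::euclidean_space \<Rightarrow> 'a \<Rightarrow> bool) \<Rightarrow> 'a \<Rightarrow> 'a \<Rightarrow> bool" where
  "causal_le fut x y \<longleftrightarrow> x = y \<or> (\<exists>\<gamma> a b. pw_C1_curve fut \<gamma> a b \<and> \<gamma> a = x \<and> \<gamma> b = y)"

definition chron_past ::
  "('a::euclidean_space \<Rightarrow> 'a \<Rightarrow> 'a \<Rightarrow> real) \<Rightarrow> ('a \<Rightarrow> 'a \<Rightarrow> bool) \<Rightarrow> 'a set \<Rightarrow> 'a set" where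
  "chron_past g fut A =
     {x. \<exists>\<gamma> a b. pw_C1_curve (future_timelike g fut) \<gamma> a b \<and> \<gamma> a = x \<and> \<gamma> b \<in> A}"

definition time_sep ::
  "('a::euclidean_space \<Rightarrow> 'a \<Rightarrow> 'a \<Rightarrow> real) \<Rightarrow> ('a \<Rightarrow> 'a \<Rightarrow> bool) \<Rightarrow> 'a \<Rightarrow> 'a \<Rightarrow> ereal" where
  "time_sep g fut x y =
     (if x = y then 0
      else if causal_le fut x y then
        Sup {ereal (curve_length g \<gamma> a b) |\<gamma> a b. pw_C1_curve fut \<gamma> a b \<and> \<gamma> a = x \<and> \<gamma> b = y}
      else - \<infinity>)"

definition time_sep_sets ::
  "('a::euclidean_space \<Rightarrow> 'a \<Rightarrow> 'a \<Rightarrow> real) \<Rightarrow> ('a \<Rightarrow> 'a \<Rightarrow> bool) \<Rightarrow> 'a set \<Rightarrow> 'a set \<Rightarrow> ereal" where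
  "time_sep_sets g fut A B = (SUP x\<in>A. SUP y\<in>B. time_sep g fut x y)"

section \<open>Cauchy hypersurfaces\<close>

definition causal_curve_on ::
  "('a::euclidean_space \<Rightarrow> 'a \<Rightarrow> bool) \<Rightarrow> real set \<Rightarrow> (real \<Rightarrow> 'a) \<Rightarrow> bool" where
  "causal_curve_on fut I \<gamma> \<longleftrightarrow> is_interval I \<and> I \<noteq> {} \<and>
     (\<forall>c\<in>I. \<forall>d\<in>I. c < d \<longrightarrow> pw_C1_curve fut \<gamma> c d)"

definition future_endpoint :: "real set \<Rightarrow> (real \<Rightarrow> 'a::topological_space) \<Rightarrow> 'a \<Rightarrow> bool" where
  "future_endpoint I \<gamma> p \<longleftrightarrow>
     (\<forall>W. open W \<and> p \<in> W \<longrightarrow> (\<exists>s\<in>I. \<forall>t\<in>I. s \<le> t \<longrightarrow> \<gamma> t \<in> W))"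

definition past_endpoint :: "real set \<Rightarrow> (real \<Rightarrow> 'a::topological_space) \<Rightarrow> 'a \<Rightarrow> bool" where
  "past_endpoint I \<gamma> p \<longleftrightarrow>
     (\<forall>W. open W \<and> p \<in> W \<longrightarrow> (\<exists>s\<in>I. \<forall>t\<in>I. t \<le> s \<longrightarrow> \<gamma> t \<in> W))"

(* If I contains its supremum or infimum, the value of the curve there is an endpoint; so an
   inextendible curve automatically has an open parameter interval. *)
definition inextendible_causal_curve ::
  "('a::euclidean_space \<Rightarrow> 'a \<Rightarrow> bool) \<Rightarrow> real set \<Rightarrow> (real \<Rightarrow> 'a) \<Rightarrow> bool" where
  "inextendible_causal_curve fut I \<gamma> \<longleftrightarrow> causal_curve_on fut I \<gamma> \<and>
     (\<nexists>p. future_endpoint I \<gamma> p) \<and> (\<nexists>p. past_endpoint I \<gamma> p)"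

definition cauchy_hypersurface ::
  "('a::euclidean_space \<Rightarrow> 'a \<Rightarrow> bool) \<Rightarrow> 'a set \<Rightarrow> bool" where
  "cauchy_hypersurface fut S \<longleftrightarrow>
     (\<forall>I \<gamma>. inextendible_causal_curve fut I \<gamma> \<longrightarrow> (\<exists>!t. t \<in> I \<and> \<gamma> t \<in> S))"

section \<open>Temporal functions\<close>

primrec C_k :: "nat \<Rightarrow> ('a::euclidean_space \<Rightarrow> real) \<Rightarrow> bool" where
  "C_k 0 f \<longleftrightarrow> continuous_on UNIV f"
| "C_k (Suc k) f \<longleftrightarrow>
     (\<exists>f'. (\<forall>x. (f has_derivative f' x) (at x)) \<and> (\<forall>v. C_k k (\<lambda>x. f' x v)))"

definition C_infinity :: "('a::euclidean_space \<Rightarrow> real) \<Rightarrow> bool" where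
  "C_infinity f \<longleftrightarrow> (\<forall>k. C_k k f)"

abbreviation differential :: "('a::euclidean_space \<Rightarrow> real) \<Rightarrow> 'a \<Rightarrow> 'a \<Rightarrow> real" where
  "differential f p V \<equiv> frechet_derivative f (at p) V"

definition is_gradient ::
  "('a::euclidean_space \<Rightarrow> 'a \<Rightarrow> 'a \<Rightarrow> real) \<Rightarrow> ('a \<Rightarrow> real) \<Rightarrow> 'a \<Rightarrow> 'a \<Rightarrow> bool" where
  "is_gradient g f p X \<longleftrightarrow> (\<forall>V. g p X V = differential f p V)"

definition temporal ::
  "('a::euclidean_space \<Rightarrow> 'a \<Rightarrow> 'a \<Rightarrow> real) \<Rightarrow> ('a \<Rightarrow> 'a \<Rightarrow> bool) \<Rightarrow> ('a \<Rightarrow> real) \<Rightarrow> bool" where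
  "temporal g fut f \<longleftrightarrow> C_infinity f \<and>
     (\<forall>p. \<exists>X. is_gradient g f p X \<and> future_timelike g fut p X)"

definition cauchy_function ::
  "('a::euclidean_space \<Rightarrow> 'a \<Rightarrow> bool) \<Rightarrow> ('a \<Rightarrow> real) \<Rightarrow> bool" where
  "cauchy_function fut f \<longleftrightarrow> (\<forall>s. cauchy_hypersurface fut {p. f p = s})"

section \<open>Local equi-Lipschitz continuity\<close>

(* In ereal the difference of two equal infinite values is infinite, so the inequality with
   x = y forces the time separation to be finite on U. *)
definition locally_equi_Lipschitz ::
  "('a::euclidean_space \<Rightarrow> 'a \<Rightarrow> 'a \<Rightarrow> real) \<Rightarrow> ('a \<Rightarrow> 'a \<Rightarrow> bool) \<Rightarrow> ('a \<Rightarrow> 'a \<Rightarrow> 'a \<Rightarrow> real) \<Rightarrow>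
     (real \<Rightarrow> 'a set) \<Rightarrow> bool" where
  "locally_equi_Lipschitz g fut h \<Sigma> \<longleftrightarrow>
     (\<forall>q. \<exists>U. open U \<and> q \<in> U \<and>
       (\<exists>C>0. \<exists>t\<^sub>0>0. \<forall>t\<ge>t\<^sub>0. U \<subseteq> chron_past g fut (\<Sigma> t) \<and>
         (\<forall>x\<in>U. \<forall>y\<in>U.
           \<bar>time_sep_sets g fut {x} (\<Sigma> t) - time_sep_sets g fut {y} (\<Sigma> t)\<bar>
             \<le> ereal (C * riem_dist h x y))))"

section \<open>The Minkowski plane in null coordinates\<close>

(* Here 2 du dv denotes the symmetric product, so that g(V,V) = 2 A B for V = (A,B). *)
definition mink :: "real \<times> real \<Rightarrow> real \<times> real \<Rightarrow> real \<times> real \<Rightarrow> real" where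
  "mink p V W = fst V * snd W + snd V * fst W"

definition mink_future :: "real \<times> real \<Rightarrow> real \<times> real \<Rightarrow> bool" where
  "mink_future p V \<longleftrightarrow> fst V \<ge> 0 \<and> snd V \<ge> 0 \<and> max (fst V) (snd V) > 0"

definition eucl :: "real \<times> real \<Rightarrow> real \<times> real \<Rightarrow> real \<times> real \<Rightarrow> real" where
  "eucl p V W = fst V * fst W + snd V * snd W"

definition F :: "real \<Rightarrow> real" where
  "F u = u + u ^ 3 / 3"

definition tau :: "real \<times> real \<Rightarrow> real" where
  "tau p = F (fst p) + snd p"

definition Sigma_level :: "real \<Rightarrow> (real \<times> real) set" where
  "Sigma_level s = {p. tau p = s}"

end

theory Submission
  imports Defs
begin

text \<open>
  The differential of \<open>tau\<close> at \<open>(u, v)\<close> is \<open>(1 + u\<^sup>2) du + dv\<close>, so its gradient is \<open>(1, 1 + u\<^sup>2)\<close> and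
  both steepness estimates follow from \<open>d tau (A, B) \<ge> A + B\<close>.  Along a causal curve both null
  coordinates are nondecreasing.  If \<open>tau\<close> stayed below (above) a level, both coordinates would
  be bounded above (below) along the curve, because \<open>F\<close> is unbounded in both directions; being
  monotone they would converge, and the limit would be an endpoint.  Hence every
  inextendible causal curve meets each level, and only once since \<open>tau\<close> strictly increases.

  The Lipschitz constants blow up for the following reason.  A curve maximizing the length from
  the origin to the level \<open>t = 4/3 m\<^sup>3\<close> ends near \<open>u = m\<close>, \<open>v = m\<^sup>3\<close>; it becomes almost parallel to the
  null direction \<open>(0, 1)\<close>, and the derivative of the time separation in the direction of \<open>u\<close> is of
  size \<open>m\<close>.  To make this quantitative without computing the maximum, use a calibration.  By the
  inequality of arithmetic and geometric means the linear function \<open>(m u + v / m) / sqrt 2\<close>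
  increases along a causal curve by at least the length of the curve
  (\<open>mink_length_le_calibration\<close>).  A tangent line of the function \<open>u\<^sup>3\<close>, convex for \<open>u \<ge> 0\<close>, bounds
  this linear function on the level, which gives \<open>sqrt 2 (m\<^sup>2 - m d / 2)\<close> as an upper bound for the
  time separation from \<open>(d, 0)\<close> (\<open>time_sep_to_level_le\<close>); the straight segment to \<open>(m, m\<^sup>3 - m)\<close> gives
  \<open>sqrt 2 (m\<^sup>2 - 1)\<close> as a lower bound from the origin (\<open>time_sep_to_level_ge\<close>).  The difference of
  the bounds tends to infinity with \<open>m\<close> while the Euclidean distance of the two points is at most
  \<open>d\<close>.
\<close>

section \<open>Piecewise continuously differentiable curves\<close>

text \<open>
  Between two neighbouring break points the one-sided derivatives agree with the two-sided one.
  In this form the fundamental theorem of calculus with finitely many exceptions applies to the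
  curve as a whole, without a sum over the pieces.
\<close>
lemma pw_C1_curve_regular:
  assumes "pw_C1_curve P \<gamma> a b"
  obtains S where "finite S" "continuous_on {a..b} \<gamma>"
    "\<And>t. t \<in> {a..b} - S \<Longrightarrow> (\<gamma> has_vector_derivative vector_derivative \<gamma> (at t)) (at t)"
    "\<And>t. t \<in> {a..b} - S \<Longrightarrow> P (\<gamma> t) (vector_derivative \<gamma> (at t))"
proof -
  have ab: "a < b" using assms unfolding pw_C1_curve_def by (rule conjunct1)
  from assms[unfolded pw_C1_curve_def, THEN conjunct2]
  obtain S where S_all: "finite S \<and> {a, b} \<subseteq> S \<and> S \<subseteq> {a..b} \<and>
      (\<forall>c\<in>S. \<forall>d\<in>S. c < d \<and> {c<..<d} \<inter> S = {} \<longrightarrow>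
         (\<exists>\<gamma>'. continuous_on {c..d} \<gamma>' \<and>
           (\<forall>t\<in>{c..d}. (\<gamma> has_vector_derivative \<gamma>' t) (at t within {c..d}) \<and> P (\<gamma> t) (\<gamma>' t))))"
    by (rule exE)
  note S = S_all[THEN conjunct1] S_all[THEN conjunct2, THEN conjunct1]
    S_all[THEN conjunct2, THEN conjunct2, THEN conjunct1]
  note all_pieces = S_all[THEN conjunct2, THEN conjunct2, THEN conjunct2]
  define J where "J = {(c, d). c \<in> S \<and> d \<in> S \<and> c < d \<and> {c<..<d} \<inter> S = {}}"
  have pieces: "\<exists>\<gamma>'. continuous_on {c..d} \<gamma>' \<and>
      (\<forall>t\<in>{c..d}. (\<gamma> has_vector_derivative \<gamma>' t) (at t within {c..d}) \<and> P (\<gamma> t) (\<gamma>' t))"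
    if "(c, d) \<in> J" for c d
    using that by (intro all_pieces[rule_format]) (auto simp: J_def)
  have finJ: "finite J"
    by (rule finite_subset[of _ "S \<times> S"]) (auto simp: J_def S(1))
  have gap: "\<exists>c d. (c, d) \<in> J \<and> c < t \<and> t < d" if "t \<in> {a..b} - S" for t
  proof -
    define c where "c = Max {s \<in> S. s < t}"
    define d where "d = Min {s \<in> S. t < s}"
    have "a \<noteq> t" "b \<noteq> t" using that S(2) by auto
    hence ne: "a \<in> {s \<in> S. s < t}" "b \<in> {s \<in> S. t < s}" using that S(2) by auto
    have c: "c \<in> {s \<in> S. s < t}" unfolding c_def using ne S(1) by (intro Max_in) auto
    have d: "d \<in> {s \<in> S. t < s}" unfolding d_def using ne S(1) by (intro Min_in) auto
    have "{c<..<d} \<inter> S = {}"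
    proof (rule ccontr)
      assume "{c<..<d} \<inter> S \<noteq> {}"
      then obtain s where s: "s \<in> S" "c < s" "s < d" by auto
      have "s \<le> c" if "s < t" unfolding c_def using that s S(1) by (intro Max_ge) auto
      moreover have "d \<le> s" if "t < s" unfolding d_def using that s S(1) by (intro Min_le) auto
      moreover have "s \<noteq> t" using s \<open>t \<in> {a..b} - S\<close> by auto
      ultimately show False using s by force
    qed
    thus ?thesis using c d unfolding J_def by (intro exI[of _ c] exI[of _ d]) auto
  qed
  have deriv: "(\<gamma> has_vector_derivative vector_derivative \<gamma> (at t)) (at t) \<and>
      P (\<gamma> t) (vector_derivative \<gamma> (at t))" if t: "t \<in> {a..b} - S" for t
  proof -
    obtain c d where cd: "(c, d) \<in> J" "c < t" "t < d" using gap[OF t] by blast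
    obtain \<gamma>' where "\<forall>t\<in>{c..d}. (\<gamma> has_vector_derivative \<gamma>' t) (at t within {c..d}) \<and> P (\<gamma> t) (\<gamma>' t)"
      using pieces[OF cd(1)] by (elim exE conjE, intro that)
    hence D: "(\<gamma> has_vector_derivative \<gamma>' t) (at t within {c..d})" "P (\<gamma> t) (\<gamma>' t)"
      using cd by auto
    have "at t within {c..d} = at t" using cd by (intro at_within_interior) auto
    hence "(\<gamma> has_vector_derivative \<gamma>' t) (at t)" using D by simp
    thus ?thesis using D vector_derivative_at by metis
  qed
  have cont_piece: "continuous_on {c..d} \<gamma>" if J: "(c, d) \<in> J" for c d
    using pieces[OF J] by (elim exE conjE) (rule continuous_on_vector_derivative, drule (1) bspec, erule conjunct1)
  have cover: "{a..b} \<subseteq> (\<Union>(c, d)\<in>J. {c..d})"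
  proof
    fix t assume t: "t \<in> {a..b}"
    show "t \<in> (\<Union>(c, d)\<in>J. {c..d})"
    proof (cases "t \<in> S")
      case False
      then obtain c d where "(c, d) \<in> J" "c < t" "t < d" using gap t by blast
      thus ?thesis by (intro UN_I[of "(c, d)"]) auto
    next
      case tS: True
      \<comment> \<open>A break point closes the piece on its left, except for \<open>a\<close>, which opens the first piece.\<close>
      show ?thesis
      proof (cases "t = a")
        case True
        define d where "d = Min {s \<in> S. a < s}"
        have d: "d \<in> {s \<in> S. a < s}" unfolding d_def using S ab by (intro Min_in) auto
        have "d \<le> s" if "s \<in> S" "a < s" for s
          unfolding d_def using that S(1) by (intro Min_le) auto
        hence "(a, d) \<in> J" using d S(2) unfolding J_def by force
        thus ?thesis using True d by (intro UN_I[of "(a, d)"]) auto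
      next
        case False
        define c where "c = Max {s \<in> S. s < t}"
        have "a \<in> {s \<in> S. s < t}" using False t S(2) by auto
        hence c: "c \<in> {s \<in> S. s < t}" unfolding c_def using S by (intro Max_in) auto
        have "s \<le> c" if "s \<in> S" "s < t" for s
          unfolding c_def using that S(1) by (intro Max_ge) auto
        hence "(c, t) \<in> J" using c tS unfolding J_def by force
        thus ?thesis using c by (intro UN_I[of "(c, t)"]) auto
      qed
    qed
  qed
  have "continuous_on (\<Union>(c, d)\<in>J. {c..d}) \<gamma>"
    using finJ cont_piece by (intro continuous_on_closed_Union) auto
  hence "continuous_on {a..b} \<gamma>" using cover continuous_on_subset by blast
  thus thesis using that[of S] S(1) deriv by blast
qed

lemma pw_C1_curve_segment:
  assumes "\<And>p. P p V"
  shows "pw_C1_curve P (\<lambda>t. x + t *\<^sub>R V) 0 1"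
  unfolding pw_C1_curve_def
proof (intro conjI exI[of _ "{0, 1}"] ballI impI)
  fix c d :: real assume "c \<in> {0, 1}" "d \<in> {0, 1}" "c < d \<and> {c<..<d} \<inter> {0, 1} = {}"
  show "\<exists>\<gamma>'. continuous_on {c..d} \<gamma>' \<and> (\<forall>t\<in>{c..d}.
      ((\<lambda>t. x + t *\<^sub>R V) has_vector_derivative \<gamma>' t) (at t within {c..d}) \<and> P (x + t *\<^sub>R V) (\<gamma>' t))"
    by (rule exI[of _ "\<lambda>_. V"]) (auto intro!: derivative_eq_intros assms)
qed auto

lemma curve_length_segment:
  assumes "\<And>p. k p V V = e"
  shows "curve_length k (\<lambda>t. x + t *\<^sub>R V) 0 1 = sqrt e"
proof -
  have "vector_derivative (\<lambda>t. x + t *\<^sub>R V) (at t) = V" for t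
    by (rule vector_derivative_at) (auto intro!: derivative_eq_intros)
  thus ?thesis by (simp add: curve_length_def assms)
qed

section \<open>Causal curves in the Minkowski plane\<close>

lemma causal_curve_has_integral:
  fixes \<gamma> :: "real \<Rightarrow> real \<times> real" and \<alpha> \<beta> :: real
  assumes \<gamma>: "pw_C1_curve mink_future \<gamma> a b"
  defines "w \<equiv> \<lambda>t. vector_derivative \<gamma> (at t)"
  shows "((\<lambda>t. \<alpha> * fst (w t) + \<beta> * snd (w t)) has_integral
      (\<alpha> * (fst (\<gamma> b) - fst (\<gamma> a)) + \<beta> * (snd (\<gamma> b) - snd (\<gamma> a)))) {a..b}"
proof -
  obtain S where S: "finite S" "continuous_on {a..b} \<gamma>"
    "\<And>t. t \<in> {a..b} - S \<Longrightarrow> (\<gamma> has_vector_derivative w t) (at t)"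
    using pw_C1_curve_regular[OF \<gamma>] unfolding w_def by metis
  have "a \<le> b" using \<gamma> unfolding pw_C1_curve_def by auto
  have "(w has_integral (\<gamma> b - \<gamma> a)) {a..b}"
    using fundamental_theorem_of_calculus_interior_strong[OF S(1) \<open>a \<le> b\<close> _ S(2)] S(3) by auto
  moreover have "bounded_linear (\<lambda>p :: real \<times> real. \<alpha> * fst p + \<beta> * snd p)"
    by (intro bounded_linear_add bounded_linear_const_mult bounded_linear_fst bounded_linear_snd
        bounded_linear_ident)
  ultimately show ?thesis
    using has_integral_linear[of w "\<gamma> b - \<gamma> a" "{a..b}"] by (fastforce simp: o_def)
qed

lemma causal_curve_coords_mono:
  assumes \<gamma>: "pw_C1_curve mink_future \<gamma> a b"
  shows "fst (\<gamma> a) \<le> fst (\<gamma> b)" "snd (\<gamma> a) \<le> snd (\<gamma> b)"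
proof -
  let ?w = "\<lambda>t. vector_derivative \<gamma> (at t)"
  obtain S where S: "finite S" "\<And>t. t \<in> {a..b} - S \<Longrightarrow> mink_future (\<gamma> t) (?w t)"
    using pw_C1_curve_regular[OF \<gamma>] by metis
  have *: "0 \<le> \<alpha> * (fst (\<gamma> b) - fst (\<gamma> a)) + \<beta> * (snd (\<gamma> b) - snd (\<gamma> a))"
    if "\<alpha> \<ge> 0" "\<beta> \<ge> 0" for \<alpha> \<beta>
  proof (rule has_integral_nonneg)
    let ?f = "\<lambda>t. if t \<in> S then 0 else \<alpha> * fst (?w t) + \<beta> * snd (?w t)"
    show "(?f has_integral (\<alpha> * (fst (\<gamma> b) - fst (\<gamma> a)) + \<beta> * (snd (\<gamma> b) - snd (\<gamma> a)))) {a..b}"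
      by (rule has_integral_spike_finite[OF S(1) _ causal_curve_has_integral[OF \<gamma>]]) auto
    show "0 \<le> ?f t" if "t \<in> {a..b}" for t
      using S(2)[of t] that \<open>\<alpha> \<ge> 0\<close> \<open>\<beta> \<ge> 0\<close> unfolding mink_future_def by auto
  qed
  show "fst (\<gamma> a) \<le> fst (\<gamma> b)" "snd (\<gamma> a) \<le> snd (\<gamma> b)" using *[of 1 0] *[of 0 1] by auto
qed

text \<open>
  The integrand is at most \<open>(\<alpha> A + B / \<alpha>) / sqrt 2\<close> for a velocity \<open>(A, B)\<close>, by the inequality of
  arithmetic and geometric means.  For \<open>\<alpha>\<^sup>2\<close> equal to the slope \<open>B / A\<close> of a segment this is sharp.
\<close>
lemma mink_length_le_calibration:
  assumes \<gamma>: "pw_C1_curve mink_future \<gamma> a b" and \<alpha>: "\<alpha> > 0"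
  shows "curve_length mink \<gamma> a b \<le>
    (\<alpha> * (fst (\<gamma> b) - fst (\<gamma> a)) + (snd (\<gamma> b) - snd (\<gamma> a)) / \<alpha>) / sqrt 2"
proof -
  let ?w = "\<lambda>t. vector_derivative \<gamma> (at t)"
  let ?g = "\<lambda>t. sqrt (mink (\<gamma> t) (?w t) (?w t))"
  let ?D = "(\<alpha> * (fst (\<gamma> b) - fst (\<gamma> a)) + (snd (\<gamma> b) - snd (\<gamma> a)) / \<alpha>) / sqrt 2"
  obtain S where S: "finite S" "\<And>t. t \<in> {a..b} - S \<Longrightarrow> mink_future (\<gamma> t) (?w t)"
    using pw_C1_curve_regular[OF \<gamma>] by metis
  have amgm: "sqrt (mink p V V) \<le> (\<alpha> * fst V + snd V / \<alpha>) / sqrt 2" if "mink_future p V" for p V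
  proof (rule real_le_lsqrt)
    show "0 \<le> (\<alpha> * fst V + snd V / \<alpha>) / sqrt 2"
      using that \<alpha> unfolding mink_future_def by auto
    have "4 * (\<alpha> * fst V) * (snd V / \<alpha>) \<le> (\<alpha> * fst V + snd V / \<alpha>)\<^sup>2"
      using sum_squares_bound[of "\<alpha> * fst V" "snd V / \<alpha>"] \<alpha> by (simp add: power2_sum)
    thus "mink p V V \<le> ((\<alpha> * fst V + snd V / \<alpha>) / sqrt 2)\<^sup>2"
      using \<alpha> by (simp add: mink_def power_divide)
  qed
  show ?thesis
  proof (cases "?g integrable_on {a..b}")
    case True
    let ?f = "\<lambda>t. if t \<in> S then ?g t else (\<alpha> * fst (?w t) + snd (?w t) / \<alpha>) / sqrt 2"
    have "((\<lambda>t. \<alpha> / sqrt 2 * fst (?w t) + 1 / (\<alpha> * sqrt 2) * snd (?w t)) has_integral ?D) {a..b}"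
      using causal_curve_has_integral[OF \<gamma>, of "\<alpha> / sqrt 2" "1 / (\<alpha> * sqrt 2)"]
      by (simp add: add_divide_distrib)
    hence "(?f has_integral ?D) {a..b}"
      by (rule has_integral_spike_finite[OF S(1), rotated]) (simp add: add_divide_distrib)
    moreover have "?g t \<le> ?f t" if "t \<in> {a..b}" for t
      using amgm S(2)[of t] that by auto
    ultimately show ?thesis
      unfolding curve_length_def using True by (intro has_integral_le[OF integrable_integral]) auto
  next
    case False
    \<comment> \<open>The integral of a function that is not integrable has the value \<open>0\<close>.\<close>
    hence "curve_length mink \<gamma> a b = 0"
      unfolding curve_length_def by (rule not_integrable_integral)
    thus ?thesis using causal_curve_coords_mono[OF \<gamma>] \<alpha> by simp
  qed
qed

section \<open>The function \<open>tau\<close>\<close>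

lemma F_strict_mono: "strict_mono F"
proof (rule strict_monoI)
  fix x y :: real assume "x < y"
  moreover have "x ^ 3 \<le> y ^ 3" using \<open>x < y\<close> by (intro power_mono_odd) auto
  ultimately show "F x < F y" unfolding F_def by (intro add_less_le_mono) auto
qed

lemma F_mono_iff [simp]: "F x \<le> F y \<longleftrightarrow> x \<le> y" "F x < F y \<longleftrightarrow> x < y"
  using strict_mono_less_eq[OF F_strict_mono] strict_mono_less[OF F_strict_mono] by auto

lemma tau_has_derivative:
  "(tau has_derivative (\<lambda>V. (1 + (fst p)\<^sup>2) * fst V + snd V)) (at p)"
proof -
  have "tau = (\<lambda>p. fst p + fst p ^ 3 / 3 + snd p)" by (auto simp: tau_def F_def)
  show ?thesis
    unfolding \<open>tau = _\<close>
    by (auto intro!: derivative_eq_intros simp: algebra_simps power2_eq_square)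
qed

lemma differential_tau: "differential tau p V = (1 + (fst p)\<^sup>2) * fst V + snd V"
  using frechet_derivative_at[OF tau_has_derivative, of p] by metis

text \<open>
  The derivative of such a function in a fixed direction \<open>V\<close> is again of this form, with the
  polynomial \<open>smult (fst V) (pderiv p) + [:c * snd V:]\<close> and \<open>c = 0\<close>, so the induction closes.
\<close>
lemma C_k_poly_fst_plus_snd:
  "C_k k (\<lambda>x :: real \<times> real. poly p (fst x) + c * snd x)"
proof (induction k arbitrary: p c)
  case 0
  show ?case by (auto intro!: continuous_intros)
next
  case (Suc k)
  let ?D = "\<lambda>(x :: real \<times> real) (V :: real \<times> real). poly (pderiv p) (fst x) * fst V + c * snd V"
  have "((\<lambda>x. poly p (fst x) + c * snd x) has_derivative ?D x) (at x)" for x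
  proof -
    have "(poly p has_derivative (\<lambda>h. poly (pderiv p) (fst x) * h)) (at (fst x))"
      using poly_DERIV[of p "fst x"] by (simp add: has_field_derivative_def)
    from has_derivative_compose[OF has_derivative_fst[OF has_derivative_ident] this]
    show ?thesis by (auto intro!: derivative_eq_intros)
  qed
  moreover have "C_k k (\<lambda>x. ?D x V)" for V
    using Suc[of "smult (fst V) (pderiv p) + [:c * snd V:]" 0] by (simp add: mult.commute)
  ultimately show ?case unfolding C_k.simps by (intro exI[of _ ?D]) simp
qed

lemma C_infinity_tau: "C_infinity tau"
proof -
  have "tau = (\<lambda>x. poly [:0, 1, 0, 1/3:] (fst x) + 1 * snd x)"
    by (auto simp: tau_def F_def power3_eq_cube fun_eq_iff algebra_simps)
  thus ?thesis unfolding C_infinity_def using C_k_poly_fst_plus_snd by metis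
qed

lemma temporal_tau: "temporal mink mink_future tau"
  unfolding temporal_def
proof (intro conjI allI C_infinity_tau)
  fix p :: "real \<times> real"
  have "1 + (fst p)\<^sup>2 > 0" by (simp add: add_pos_nonneg)
  hence "is_gradient mink tau p (1, 1 + (fst p)\<^sup>2) \<and>
      future_timelike mink mink_future p (1, 1 + (fst p)\<^sup>2)"
    by (auto simp: is_gradient_def differential_tau mink_def future_timelike_def mink_future_def)
  thus "\<exists>X. is_gradient mink tau p X \<and> future_timelike mink mink_future p X" by blast
qed

lemma tau_steep:
  assumes "mink_future p V"
  shows "differential tau p V \<ge> max (sqrt (eucl p V V)) (sqrt (mink p V V))"
proof -
  have V: "fst V \<ge> 0" "snd V \<ge> 0" using assms by (auto simp: mink_future_def)
  have "sqrt (eucl p V V) \<le> fst V + snd V" "sqrt (mink p V V) \<le> fst V + snd V"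
    using V by (auto intro!: real_le_lsqrt simp: eucl_def mink_def power2_eq_square algebra_simps)
  moreover have "fst V + snd V \<le> differential tau p V"
    using V by (simp add: differential_tau algebra_simps)
  ultimately show ?thesis by simp
qed

text \<open>
  Otherwise the monotone coordinates would have equal values at both ends, the curve would be
  constant, and its velocity would vanish, which a causal vector does not.
\<close>
lemma tau_strict_mono_causal_curve:
  assumes \<gamma>: "causal_curve_on mink_future I \<gamma>" and I: "c \<in> I" "d \<in> I" and "c < d"
  shows "tau (\<gamma> c) < tau (\<gamma> d)"
proof -
  have pw: "pw_C1_curve mink_future \<gamma> s t" if "s \<in> {c..d}" "t \<in> {c..d}" "s < t" for s t
  proof -
    have "is_interval I" using \<gamma> by (simp add: causal_curve_on_def)
    hence "s \<in> I" "t \<in> I" using that I mem_is_interval_1_I[of I c d] by auto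
    thus ?thesis using \<gamma> that(3) by (auto simp: causal_curve_on_def)
  qed
  have mono: "fst (\<gamma> s) \<le> fst (\<gamma> t)" "snd (\<gamma> s) \<le> snd (\<gamma> t)"
    if "s \<in> {c..d}" "t \<in> {c..d}" "s \<le> t" for s t
    using causal_curve_coords_mono[OF pw[of s t]] that by (cases "s = t"; auto)+
  have le: "fst (\<gamma> c) \<le> fst (\<gamma> d)" "snd (\<gamma> c) \<le> snd (\<gamma> d)" using mono[of c d] \<open>c < d\<close> by auto
  have "\<gamma> c \<noteq> \<gamma> d"
  proof
    assume eq: "\<gamma> c = \<gamma> d"
    have const: "\<gamma> t = \<gamma> c" if "t \<in> {c..d}" for t
    proof -
      have "fst (\<gamma> c) \<le> fst (\<gamma> t)" "snd (\<gamma> c) \<le> snd (\<gamma> t)" using mono[of c t] that by simp_all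
      moreover have "fst (\<gamma> t) \<le> fst (\<gamma> c)" "snd (\<gamma> t) \<le> snd (\<gamma> c)"
        using mono[of t d] that unfolding eq by simp_all
      ultimately show ?thesis by (intro prod_eqI antisym)
    qed
    have pw_cd: "pw_C1_curve mink_future \<gamma> c d" using pw[of c d] \<open>c < d\<close> by simp
    obtain S where S: "finite S"
      "\<And>t. t \<in> {c..d} - S \<Longrightarrow> (\<gamma> has_vector_derivative vector_derivative \<gamma> (at t)) (at t)"
      "\<And>t. t \<in> {c..d} - S \<Longrightarrow> mink_future (\<gamma> t) (vector_derivative \<gamma> (at t))"
      using pw_C1_curve_regular[OF pw_cd] by metis
    have "\<not> {c<..<d} \<subseteq> S"
      using S(1) \<open>c < d\<close> finite_subset infinite_Ioo by blast
    then obtain t where "t \<in> {c<..<d}" "t \<notin> S" by (meson subsetI)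
    hence t: "c < t" "t < d" "t \<notin> S" by simp_all
    have "(\<gamma> has_vector_derivative 0) (at t)"
    proof (rule has_vector_derivative_transform_within_open[of "\<lambda>_. \<gamma> c" _ _ "{c<..<d}"])
      show "((\<lambda>_. \<gamma> c) has_vector_derivative 0) (at t)" by simp
      show "open {c<..<d}" "t \<in> {c<..<d}" using t by simp_all
      show "\<gamma> c = \<gamma> r" if "r \<in> {c<..<d}" for r
        by (rule const[symmetric]) (use that in simp)
    qed
    hence "vector_derivative \<gamma> (at t) = 0" by (rule vector_derivative_at)
    thus False using S(3)[of t] t by (simp add: mink_future_def)
  qed
  hence "fst (\<gamma> c) < fst (\<gamma> d) \<or> snd (\<gamma> c) < snd (\<gamma> d)"
    using le by (auto simp: prod_eq_iff)
  hence "F (fst (\<gamma> c)) < F (fst (\<gamma> d)) \<or> snd (\<gamma> c) < snd (\<gamma> d)" by simp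
  moreover have "F (fst (\<gamma> c)) \<le> F (fst (\<gamma> d))" using le by simp
  ultimately show ?thesis using le unfolding tau_def by linarith
qed

section \<open>Level sets are Cauchy hypersurfaces\<close>

lemma future_endpoint_Pair:
  assumes "future_endpoint I (\<lambda>t. fst (\<gamma> t)) x" "future_endpoint I (\<lambda>t. snd (\<gamma> t)) y"
  shows "future_endpoint I \<gamma> (x, y)"
  unfolding future_endpoint_def
proof (intro allI impI)
  fix W assume "open W \<and> (x, y) \<in> W"
  then obtain A B where AB: "open A" "open B" "x \<in> A" "y \<in> B" "A \<times> B \<subseteq> W"
    by (metis open_prod_elim mem_Times_iff fst_conv snd_conv)
  then obtain r s where rs: "r \<in> I" "s \<in> I" "\<And>t. t \<in> I \<Longrightarrow> r \<le> t \<Longrightarrow> fst (\<gamma> t) \<in> A"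
    "\<And>t. t \<in> I \<Longrightarrow> s \<le> t \<Longrightarrow> snd (\<gamma> t) \<in> B"
    using assms unfolding future_endpoint_def by metis
  have "max r s \<in> I" using rs by (simp add: max_def)
  moreover have "\<gamma> t \<in> W" if "t \<in> I" "max r s \<le> t" for t
    using rs that AB(5) mem_Times_iff by (metis max.bounded_iff subsetD)
  ultimately show "\<exists>s\<in>I. \<forall>t\<in>I. s \<le> t \<longrightarrow> \<gamma> t \<in> W" by blast
qed

lemma future_endpoint_Sup:
  fixes f :: "real \<Rightarrow> real"
  assumes I: "I \<noteq> {}" and mono: "\<And>s t. s \<in> I \<Longrightarrow> t \<in> I \<Longrightarrow> s \<le> t \<Longrightarrow> f s \<le> f t"
    and bdd: "bdd_above (f ` I)"
  shows "future_endpoint I f (Sup (f ` I))"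
  unfolding future_endpoint_def
proof (intro allI impI)
  fix W assume W: "open W \<and> Sup (f ` I) \<in> W"
  then obtain e where e: "e > 0" "ball (Sup (f ` I)) e \<subseteq> W" using openE by blast
  obtain s where s: "s \<in> I" "Sup (f ` I) - e < f s"
    using less_cSup_iff[of "f ` I" "Sup (f ` I) - e"] I bdd e(1) by auto
  have "f t \<in> W" if "t \<in> I" "s \<le> t" for t
  proof -
    have "f t \<le> Sup (f ` I)" using that bdd by (intro cSup_upper) auto
    moreover have "f s \<le> f t" using that s mono by auto
    ultimately have "f t \<in> ball (Sup (f ` I)) e" using s by (auto simp: dist_real_def)
    thus ?thesis using e by auto
  qed
  thus "\<exists>s\<in>I. \<forall>t\<in>I. s \<le> t \<longrightarrow> f t \<in> W" using s by blast
qed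

lemma past_endpoint_reflect:
  "past_endpoint I \<gamma> p \<longleftrightarrow> future_endpoint (uminus ` I) (\<lambda>t. \<gamma> (- t)) p"
  by (auto simp: past_endpoint_def future_endpoint_def)

lemma future_endpoint_uminus:
  fixes f :: "real \<Rightarrow> real"
  assumes "future_endpoint I (\<lambda>t. - f t) x"
  shows "future_endpoint I f (- x)"
  unfolding future_endpoint_def
proof (intro allI impI)
  fix W assume "open W \<and> - x \<in> W"
  moreover have "uminus ` W = {y. - y \<in> W}" by force
  ultimately have "open {y. - y \<in> W} \<and> x \<in> {y. - y \<in> W}"
    using open_negations[of W] by simp
  hence "\<exists>s\<in>I. \<forall>t\<in>I. s \<le> t \<longrightarrow> - f t \<in> {y. - y \<in> W}"
    using assms unfolding future_endpoint_def by blast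
  thus "\<exists>s\<in>I. \<forall>t\<in>I. s \<le> t \<longrightarrow> f t \<in> W" by auto
qed

lemma F_unbounded:
  shows "\<exists>u. y \<le> F u" "\<exists>u. F u \<le> y"
proof -
  have *: "z \<le> F \<bar>z\<bar>" for z unfolding F_def by (simp add: add_increasing2)
  have "F (- x) = - F x" for x by (simp add: F_def)
  hence "F (- \<bar>- y\<bar>) \<le> y" using *[of "- y"] by simp
  thus "\<exists>u. y \<le> F u" "\<exists>u. F u \<le> y" using *[of y] by blast+
qed

text \<open>
  As neither coordinate decreases, an upper bound for \<open>F u + v\<close> bounds each summand by subtracting
  an earlier value of the other one.  Two bounded monotone coordinates converge to their suprema.
\<close>
lemma causal_curve_bounded_tau_future_endpoint:
  assumes \<gamma>: "causal_curve_on mink_future I \<gamma>" and s: "\<And>t. t \<in> I \<Longrightarrow> tau (\<gamma> t) \<le> s"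
  shows "\<exists>p. future_endpoint I \<gamma> p"
proof -
  have mono: "fst (\<gamma> c) \<le> fst (\<gamma> d)" "snd (\<gamma> c) \<le> snd (\<gamma> d)" if "c \<in> I" "d \<in> I" "c \<le> d" for c d
    using \<gamma> that causal_curve_coords_mono[of \<gamma> c d] by (cases "c = d"; auto simp: causal_curve_on_def)+
  obtain c where c: "c \<in> I" using \<gamma> by (auto simp: causal_curve_on_def)
  obtain M where M: "s - snd (\<gamma> c) \<le> F M" using F_unbounded by blast
  have bound: "fst (\<gamma> t) \<le> M \<and> snd (\<gamma> t) \<le> s - F (fst (\<gamma> c))" if t: "t \<in> I" "c \<le> t" for t
  proof -
    have "F (fst (\<gamma> t)) \<le> F M"
      using mono[OF c t] s[OF t(1)] M unfolding tau_def by linarith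
    hence "fst (\<gamma> t) \<le> M" by simp
    moreover have "F (fst (\<gamma> c)) \<le> F (fst (\<gamma> t))" using mono[OF c t] by simp
    hence "snd (\<gamma> t) \<le> s - F (fst (\<gamma> c))" using s[OF t(1)] unfolding tau_def by linarith
    ultimately show ?thesis ..
  qed
  have bound': "fst (\<gamma> t) \<le> M \<and> snd (\<gamma> t) \<le> s - F (fst (\<gamma> c))" if t: "t \<in> I" for t
    using bound[OF t] bound[OF c] mono[OF t c] by force
  have bdd: "bdd_above ((\<lambda>t. fst (\<gamma> t)) ` I)" "bdd_above ((\<lambda>t. snd (\<gamma> t)) ` I)"
    using bound' unfolding bdd_above_def by blast+
  have "future_endpoint I \<gamma> (Sup ((\<lambda>t. fst (\<gamma> t)) ` I), Sup ((\<lambda>t. snd (\<gamma> t)) ` I))"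
    using c mono bdd by (intro future_endpoint_Pair future_endpoint_Sup) auto
  thus ?thesis by blast
qed

lemma causal_curve_bounded_tau_past_endpoint:
  assumes \<gamma>: "causal_curve_on mink_future I \<gamma>" and s: "\<And>t. t \<in> I \<Longrightarrow> s \<le> tau (\<gamma> t)"
  shows "\<exists>p. past_endpoint I \<gamma> p"
proof -
  have mono: "fst (\<gamma> c) \<le> fst (\<gamma> d)" "snd (\<gamma> c) \<le> snd (\<gamma> d)" if "c \<in> I" "d \<in> I" "c \<le> d" for c d
    using \<gamma> that causal_curve_coords_mono[of \<gamma> c d] by (cases "c = d"; auto simp: causal_curve_on_def)+
  obtain c where c: "c \<in> I" using \<gamma> by (auto simp: causal_curve_on_def)
  obtain M where M: "F M \<le> s - snd (\<gamma> c)" using F_unbounded by blast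
  have bound: "M \<le> fst (\<gamma> t) \<and> s - F (fst (\<gamma> c)) \<le> snd (\<gamma> t)" if t: "t \<in> I" "t \<le> c" for t
  proof -
    have "F M \<le> F (fst (\<gamma> t))"
      using mono[OF t(1) c t(2)] s[OF t(1)] M unfolding tau_def by linarith
    hence "M \<le> fst (\<gamma> t)" by simp
    moreover have "F (fst (\<gamma> t)) \<le> F (fst (\<gamma> c))" using mono[OF t(1) c t(2)] by simp
    hence "s - F (fst (\<gamma> c)) \<le> snd (\<gamma> t)" using s[OF t(1)] unfolding tau_def by linarith
    ultimately show ?thesis ..
  qed
  have bound': "M \<le> fst (\<gamma> t) \<and> s - F (fst (\<gamma> c)) \<le> snd (\<gamma> t)" if t: "t \<in> I" for t
    using bound[OF t] bound[OF c] mono[OF c t] by force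
  let ?J = "uminus ` I"
  let ?x = "- Sup ((\<lambda>t. - fst (\<gamma> (- t))) ` ?J)" and ?y = "- Sup ((\<lambda>t. - snd (\<gamma> (- t))) ` ?J)"
  have bdd: "bdd_above ((\<lambda>t. - fst (\<gamma> (- t))) ` ?J)"
    using bound' by (intro bdd_aboveI2[of _ _ "- M"]) auto
  have bdd': "bdd_above ((\<lambda>t. - snd (\<gamma> (- t))) ` ?J)"
    using bound' by (intro bdd_aboveI2[of _ _ "F (fst (\<gamma> c)) - s"]) (auto simp: algebra_simps)
  have "future_endpoint ?J (\<lambda>t. \<gamma> (- t)) (?x, ?y)"
    using c mono bdd bdd'
    by (intro future_endpoint_Pair future_endpoint_uminus future_endpoint_Sup) auto
  thus ?thesis using past_endpoint_reflect by blast
qed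

lemma continuous_tau: "continuous_on A tau"
  using tau_has_derivative has_derivative_continuous continuous_at_imp_continuous_on by blast

lemma cauchy_function_tau: "cauchy_function mink_future tau"
  unfolding cauchy_function_def cauchy_hypersurface_def
proof (intro allI impI)
  fix s I \<gamma> assume "inextendible_causal_curve mink_future I \<gamma>"
  hence \<gamma>: "causal_curve_on mink_future I \<gamma>"
    and no_end: "\<nexists>p. future_endpoint I \<gamma> p" "\<nexists>p. past_endpoint I \<gamma> p"
    by (auto simp: inextendible_causal_curve_def)
  obtain d where d: "d \<in> I" "s < tau (\<gamma> d)"
    using causal_curve_bounded_tau_future_endpoint[OF \<gamma>] no_end(1) by (meson not_le)
  obtain c where c: "c \<in> I" "tau (\<gamma> c) < s"
    using causal_curve_bounded_tau_past_endpoint[OF \<gamma>] no_end(2) by (meson not_le)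
  have "c < d"
    using tau_strict_mono_causal_curve[OF \<gamma> d(1) c(1)] c d by (cases c d rule: linorder_cases) auto
  hence "pw_C1_curve mink_future \<gamma> c d" using \<gamma> c d by (auto simp: causal_curve_on_def)
  hence "continuous_on {c..d} \<gamma>" using pw_C1_curve_regular by blast
  hence "continuous_on {c..d} (\<lambda>t. tau (\<gamma> t))"
    using continuous_on_compose2[OF continuous_tau[of UNIV]] by blast
  then obtain t where t: "c \<le> t" "t \<le> d" "tau (\<gamma> t) = s"
    using IVT'[of "\<lambda>t. tau (\<gamma> t)" c s d] c d \<open>c < d\<close> by auto
  have "t \<in> I"
    using \<gamma> t c d mem_is_interval_1_I[of I c d t] by (auto simp: causal_curve_on_def)
  show "\<exists>!t. t \<in> I \<and> \<gamma> t \<in> {p. tau p = s}"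
  proof (rule ex1I[of _ t])
    show "t \<in> I \<and> \<gamma> t \<in> {p. tau p = s}" using t \<open>t \<in> I\<close> by simp
    show "r = t" if "r \<in> I \<and> \<gamma> r \<in> {p. tau p = s}" for r
      using tau_strict_mono_causal_curve[OF \<gamma>, of r t] tau_strict_mono_causal_curve[OF \<gamma>, of t r]
        that t \<open>t \<in> I\<close> by (cases r t rule: linorder_cases) auto
  qed
qed

section \<open>Time separation to the levels\<close>

text \<open>
  The calibration is used with \<open>\<alpha> = m\<close>: up to a lower order term, \<open>m\<^sup>2\<close> is the slope of the
  tangent vector of the nearly maximizing segment to \<open>(m, m\<^sup>3 - m)\<close>, and the restriction of the
  calibration to the level is nearly maximal at that endpoint.
\<close>
lemma time_sep_to_level_le:
  assumes m: "m > 0" and \<delta>: "0 \<le> \<delta>" "\<delta> \<le> 2 * m"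
  shows "time_sep_sets mink mink_future {(\<delta>, 0)} (Sigma_level (4 / 3 * m ^ 3))
    \<le> ereal (sqrt 2 * (m\<^sup>2 - m * \<delta> / 2))"
proof -
  let ?B = "sqrt 2 * (m\<^sup>2 - m * \<delta> / 2)"
  have "m * \<delta> \<le> m * (2 * m)" using m \<delta> by (intro mult_left_mono) auto
  hence B: "0 \<le> ?B" by (simp add: power2_eq_square)
  have len: "curve_length mink \<gamma> a b \<le> ?B"
    if \<gamma>: "pw_C1_curve mink_future \<gamma> a b" "\<gamma> a = (\<delta>, 0)" "\<gamma> b \<in> Sigma_level (4 / 3 * m ^ 3)"
    for \<gamma> a b
  proof -
    define u where "u = fst (\<gamma> b)"
    define v where "v = snd (\<gamma> b)"
    have u: "\<delta> \<le> u" using causal_curve_coords_mono(1)[OF \<gamma>(1)] \<gamma>(2) by (simp add: u_def)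
    have v: "v = 4 / 3 * m ^ 3 - u - u ^ 3 / 3"
      using \<gamma>(3) by (simp add: Sigma_level_def tau_def F_def u_def v_def)
    \<comment> \<open>\<open>u\<^sup>3\<close> lies above its tangent line at \<open>m\<close> for \<open>u \<ge> 0\<close>.\<close>
    have "0 \<le> (u - m)\<^sup>2 * (u + 2 * m)" using u \<delta> m by simp
    hence "3 * m\<^sup>2 * u - 2 * m ^ 3 \<le> u ^ 3"
      by (simp add: power2_eq_square power3_eq_cube algebra_simps)
    hence "v \<le> m * (2 * m\<^sup>2 - m * u)"
      using u \<delta> v by (simp add: power2_eq_square power3_eq_cube algebra_simps)
    hence "v / m \<le> 2 * m\<^sup>2 - m * u" using m by (simp add: divide_le_eq mult.commute)
    hence "m * (u - \<delta>) + v / m \<le> 2 * (m\<^sup>2 - m * \<delta> / 2)" by (simp add: algebra_simps)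
    hence "(m * (u - \<delta>) + v / m) / sqrt 2 \<le> 2 * (m\<^sup>2 - m * \<delta> / 2) / sqrt 2"
      by (intro divide_right_mono) auto
    also have "\<dots> = ?B" by (simp add: field_simps)
    finally show ?thesis
      using mink_length_le_calibration[OF \<gamma>(1) m] \<gamma>(2) by (simp add: u_def v_def)
  qed
  have "time_sep mink mink_future (\<delta>, 0) z \<le> ereal ?B"
    if z: "z \<in> Sigma_level (4 / 3 * m ^ 3)" for z
  proof -
    have "Sup {ereal (curve_length mink \<gamma> a b) |\<gamma> a b.
        pw_C1_curve mink_future \<gamma> a b \<and> \<gamma> a = (\<delta>, 0) \<and> \<gamma> b = z} \<le> ereal ?B"
      using len z by (intro Sup_least) auto
    thus ?thesis using B by (simp add: time_sep_def zero_ereal_def)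
  qed
  thus ?thesis by (simp add: time_sep_sets_def SUP_le_iff)
qed

lemma time_sep_to_level_ge:
  assumes m: "m \<ge> 1"
  shows "ereal (sqrt 2 * (m\<^sup>2 - 1))
    \<le> time_sep_sets mink mink_future {(0, 0)} (Sigma_level (4 / 3 * m ^ 3))"
proof -
  define z where "z = (m, m ^ 3 - m)"
  let ?\<gamma> = "\<lambda>t :: real. (0, 0) + t *\<^sub>R z"
  have m2: "1 \<le> m\<^sup>2" using m by simp
  have z2: "m ^ 3 - m = m * (m\<^sup>2 - 1)" by (simp add: power2_eq_square power3_eq_cube algebra_simps)
  have "0 \<le> m ^ 3 - m" unfolding z2 using m m2 by simp
  hence "\<And>p. mink_future p z" using m by (auto simp: mink_future_def z_def)
  hence curve: "pw_C1_curve mink_future ?\<gamma> 0 1" by (rule pw_C1_curve_segment)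
  have "z \<in> Sigma_level (4 / 3 * m ^ 3)"
    by (simp add: z_def Sigma_level_def tau_def F_def)
  have "sqrt 2 * (m\<^sup>2 - 1) \<le> sqrt 2 * (m * sqrt (m\<^sup>2 - 1))"
  proof (intro mult_left_mono)
    have "sqrt (m\<^sup>2 - 1) \<le> m" using m by (intro real_le_lsqrt) auto
    hence "sqrt (m\<^sup>2 - 1) * sqrt (m\<^sup>2 - 1) \<le> m * sqrt (m\<^sup>2 - 1)"
      using m2 by (intro mult_right_mono) auto
    thus "m\<^sup>2 - 1 \<le> m * sqrt (m\<^sup>2 - 1)" using m2 by simp
  qed auto
  also have "\<dots> = sqrt (2 * (m * (m ^ 3 - m)))"
    unfolding z2 using m by (simp add: real_sqrt_mult)
  also have "\<dots> = curve_length mink ?\<gamma> 0 1"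
    by (subst curve_length_segment[of _ _ "2 * (m * (m ^ 3 - m))"]) (auto simp: mink_def z_def)
  finally have "ereal (sqrt 2 * (m\<^sup>2 - 1)) \<le> ereal (curve_length mink ?\<gamma> 0 1)" by simp
  also have "\<dots> \<le> Sup {ereal (curve_length mink \<gamma> a b) |\<gamma> a b.
        pw_C1_curve mink_future \<gamma> a b \<and> \<gamma> a = (0, 0) \<and> \<gamma> b = z}"
    using curve by (intro Sup_upper CollectI exI[of _ ?\<gamma>] exI[of _ 0] exI[of _ 1]) (auto simp: zero_prod_def)
  also have "\<dots> = time_sep mink mink_future (0, 0) z"
  proof -
    have "causal_le mink_future (0, 0) z"
      unfolding causal_le_def using curve
      by (intro disjI2 exI[of _ ?\<gamma>] exI[of _ 0] exI[of _ 1]) (auto simp: zero_prod_def)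
    moreover have "(0, 0) \<noteq> z" using m by (auto simp: z_def)
    ultimately show ?thesis by (simp add: time_sep_def)
  qed
  also have "\<dots> \<le> time_sep_sets mink mink_future {(0, 0)} (Sigma_level (4 / 3 * m ^ 3))"
    unfolding time_sep_sets_def using \<open>z \<in> _\<close> by (auto intro: SUP_upper)
  finally show ?thesis .
qed

lemma riem_dist_eucl_le:
  "riem_dist eucl x y \<le> norm (y - x)"
proof -
  have nonneg: "0 \<le> curve_length eucl \<gamma> a b" for \<gamma> a b
    unfolding curve_length_def
    by (cases "(\<lambda>t. sqrt (eucl (\<gamma> t) (vector_derivative \<gamma> (at t)) (vector_derivative \<gamma> (at t))))
          integrable_on {a..b}") (auto intro: integral_nonneg simp: eucl_def not_integrable_integral)
  let ?\<gamma> = "\<lambda>t :: real. x + t *\<^sub>R (y - x)"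
  have "curve_length eucl ?\<gamma> 0 1 = norm (y - x)"
    by (subst curve_length_segment[of _ _ "(norm (y - x))\<^sup>2"])
      (auto simp: eucl_def norm_prod_def power2_eq_square)
  moreover have "pw_C1_curve (\<lambda>_ _. True) ?\<gamma> 0 1" by (rule pw_C1_curve_segment) simp
  ultimately have "norm (y - x) \<in> {curve_length eucl \<gamma> a b |\<gamma> a b.
      pw_C1_curve (\<lambda>_ _. True) \<gamma> a b \<and> \<gamma> a = x \<and> \<gamma> b = y}"
    by (intro CollectI exI[of _ ?\<gamma>] exI[of _ 0] exI[of _ 1]) auto
  thus ?thesis
    unfolding riem_dist_def using nonneg by (intro cInf_lower bdd_belowI[of _ 0]) auto
qed

lemma not_locally_equi_Lipschitz_tau:
  "\<not> locally_equi_Lipschitz mink mink_future eucl Sigma_level"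
proof
  let ?L = "\<lambda>x t. time_sep_sets mink mink_future {x} (Sigma_level t)"
  assume "locally_equi_Lipschitz mink mink_future eucl Sigma_level"
  then obtain U C t0 where U: "open U" "(0, 0) \<in> U" and C: "C > 0" and "t0 > 0"
    and lip: "\<And>t x y. t \<ge> t0 \<Longrightarrow> x \<in> U \<Longrightarrow> y \<in> U \<Longrightarrow>
      \<bar>?L x t - ?L y t\<bar> \<le> ereal (C * riem_dist eucl x y)"
    unfolding locally_equi_Lipschitz_def by meson
  obtain e where e: "e > 0" "ball (0, 0) e \<subseteq> U" using U openE by blast
  define \<delta> where "\<delta> = e / 2"
  have \<delta>: "\<delta> > 0" using e by (simp add: \<delta>_def)
  have "(\<delta>, 0) \<in> U" using e by (auto simp: \<delta>_def dist_Pair_Pair)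
  \<comment> \<open>The gap between the two bounds, \<open>sqrt 2 (m \<delta> / 2 - 1)\<close>, has to exceed \<open>C \<delta>\<close>.\<close>
  define m where "m = 2 / \<delta> + 2 * C + \<delta> + t0 + 1"
  have m: "m \<ge> 1" "m > 0" "\<delta> \<le> 2 * m" "t0 \<le> m"
    using \<delta> C \<open>t0 > 0\<close> by (auto simp: m_def add_nonneg_pos)
  have "m \<le> m ^ 3" using m(1) self_le_power[of m 3] by simp
  hence t: "4 / 3 * m ^ 3 \<ge> t0" using m by linarith
  have "C * \<delta> + \<delta> / 2 \<le> m * \<delta> / 2 - 1"
    using \<delta> \<open>t0 > 0\<close> by (simp add: m_def field_simps)
  moreover have "0 < C * \<delta>" using \<delta> C by simp
  ultimately have gap: "C * \<delta> < m * \<delta> / 2 - 1" "0 < m * \<delta> / 2 - 1"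
    using \<delta> by linarith+
  have "1 * (m * \<delta> / 2 - 1) \<le> sqrt 2 * (m * \<delta> / 2 - 1)"
    using gap by (intro mult_right_mono) auto
  hence "m * \<delta> / 2 - 1 \<le> sqrt 2 * (m * \<delta> / 2 - 1)" by (simp only: mult_1)
  with gap(1) have "C * \<delta> < sqrt 2 * (m * \<delta> / 2 - 1)" by (rule less_le_trans)
  hence "ereal (C * \<delta>) < ereal (sqrt 2 * (m\<^sup>2 - 1)) - ereal (sqrt 2 * (m\<^sup>2 - m * \<delta> / 2))"
    by (simp add: algebra_simps)
  also have "\<dots> \<le> ?L (0, 0) (4 / 3 * m ^ 3) - ?L (\<delta>, 0) (4 / 3 * m ^ 3)"
    using time_sep_to_level_ge[OF m(1)] time_sep_to_level_le[OF m(2) _ m(3)] \<delta>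
    by (intro ereal_minus_mono) auto
  also have "\<dots> \<le> \<bar>?L (0, 0) (4 / 3 * m ^ 3) - ?L (\<delta>, 0) (4 / 3 * m ^ 3)\<bar>"
    by (cases "?L (0, 0) (4 / 3 * m ^ 3) - ?L (\<delta>, 0) (4 / 3 * m ^ 3)") auto
  also have "\<dots> \<le> ereal (C * riem_dist eucl (0, 0) (\<delta>, 0))"
    using lip t U \<open>(\<delta>, 0) \<in> U\<close> by blast
  also have "\<dots> \<le> ereal (C * \<delta>)"
    using riem_dist_eucl_le[of "(0, 0)" "(\<delta>, 0)"] \<delta> C by (simp add: norm_Pair)
  finally show False by simp
qed

theorem mainTheorem1:
  shows "temporal mink mink_future tau \<and>
         cauchy_function mink_future tau \<and>
         (\<forall>p V. mink_future p V \<longrightarrow>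
            differential tau p V \<ge> max (sqrt (eucl p V V)) (sqrt (mink p V V))) \<and>
         \<not> locally_equi_Lipschitz mink mink_future eucl Sigma_level"
  using temporal_tau cauchy_function_tau tau_steep not_locally_equi_Lipschitz_tau by blast

end
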